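(* Let $f\colon\mathbb{R}\to\mathbb{C}$ be a generalized polynomial such that $f(x)f(y)=0$ for all $(x,y)\in D$, where $D\subseteq\mathbb{R}^2$ is a Borel set such that either $D\notin\mathcal{M}\otimes\mathcal{N}$ or $D\notin\mathcal{N}\otimes\mathcal{M}$. Then $f(x)=0$ for each $x\in\mathbb{R}$.
   Context: Generalized polynomials: for $k\ge 1$, a function $F\colon\mathbb{R}^k\to\mathbb{C}$ is $k$-additive if it is additive in each variable separately (i.e. $F(\dots,u+v,\dots)=F(\dots,u,\dots)+F(\dots,v,\dots)$; no continuity or regularity is assumed). A function $f\colon\mathbb{R}\to\mathbb{C}$ is a generalized polynomial if there is $p\in\mathbb{N}$ such that $f(x)=\sum_{k=0}^p f_k(x)$ for all $x\in\mathbb{R}$, where $f_0$ is a constant function and, for $k=1,\dots,p$, $f_k(x)=F_k(x,x,\dots,x)$ ($k$ arguments) for some symmetric $k$-additive function $F_k\colon\mathbb{R}^k\to\mathbb{C}$. Ideals: $\mathcal{M}$ denotes the $\sigma$-ideal of meager subsets of $\mathbb{R}$ and $\mathcal{N}$ the $\sigma$-ideal of Lebesgue null subsets of $\mathbb{R}$. For $B\subseteq\mathbb{R}^2$ and $x\in\mathbb{R}$ let $B_x:=\{y\in\mathbb{R}\colon (x,y)\in B\}$. For $\sigma$-ideals $\mathcal{I},\mathcal{J}$ of subsets of $\mathbb{R}$, the Fubini product $\mathcal{I}\otimes\mathcal{J}$ is the family of all sets $A\subseteq\mathbb{R}^2$ for which there exists a Borel set $B\subseteq\mathbb{R}^2$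 with $A\subseteq B$ and $\{x\in\mathbb{R}\colon B_x\notin\mathcal{J}\}\in\mathcal{I}$. *)

theory Defs
  imports "HOL-Analysis.Analysis"
begin

text \<open>
  A point of the \<open>k\<close>-fold power of the real line is an extensional function on \<open>{..<k}\<close>,
  so that \<open>k\<close> may vary inside a formula; the values of \<open>F\<close> off \<open>real_tuples k\<close> are irrelevant.
\<close>

definition real_tuples :: "nat \<Rightarrow> (nat \<Rightarrow> real) set" where
  "real_tuples k = {..<k} \<rightarrow>\<^sub>E UNIV"

definition k_additive :: "nat \<Rightarrow> ((nat \<Rightarrow> real) \<Rightarrow> complex) \<Rightarrow> bool" where
  "k_additive k F \<longleftrightarrow>
     (\<forall>t\<in>real_tuples k. \<forall>i<k. \<forall>u v. F (t(i := u + v)) = F (t(i := u)) + F (t(i := v)))"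

definition symmetric_fun :: "nat \<Rightarrow> ((nat \<Rightarrow> real) \<Rightarrow> complex) \<Rightarrow> bool" where
  "symmetric_fun k F \<longleftrightarrow>
     (\<forall>t\<in>real_tuples k. \<forall>\<pi>. \<pi> permutes {..<k} \<longrightarrow> F (t \<circ> \<pi>) = F t)"

definition generalized_polynomial :: "(real \<Rightarrow> complex) \<Rightarrow> bool" where
  "generalized_polynomial f \<longleftrightarrow>
     (\<exists>(p::nat) (g :: nat \<Rightarrow> real \<Rightarrow> complex).
        (\<forall>x. f x = (\<Sum>k=0..p. g k x)) \<and>
        (\<exists>c. \<forall>x. g 0 x = c) \<and>
        (\<forall>k\<in>{1..p}. \<exists>F. k_additive k F \<and> symmetric_fun k F \<and>
           (\<forall>x. g k x = F (\<lambda>i\<in>{..<k}. x))))"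

definition nowhere_dense :: "'a::topological_space set \<Rightarrow> bool" where
  "nowhere_dense S \<longleftrightarrow> interior (closure S) = {}"

definition meager_sets :: "real set set" where
  "meager_sets = {A. \<exists>S :: nat \<Rightarrow> real set. (\<forall>n. nowhere_dense (S n)) \<and> A = (\<Union>n. S n)}"

text \<open>
  Completed Lebesgue measure is used because \<open>null_sets lborel\<close> contains only Borel sets.
\<close>

definition lebesgue_null_sets :: "real set set" where
  "lebesgue_null_sets = null_sets lebesgue"

definition fubini_product :: "real set set \<Rightarrow> real set set \<Rightarrow> (real \<times> real) set set"
    (infixl "\<otimes>\<^sub>F" 70) where
  "I \<otimes>\<^sub>F J =
     {A. \<exists>B\<in>sets (borel :: (real \<times> real) measure).
           A \<subseteq> B \<and> {x. {y. (x, y) \<in> B} \<notin> J} \<in> I}"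

end

theory Submission
  imports Defs
begin

text \<open>
  Along a rational line \<open>q \<mapsto> y + q u\<close> a generalized polynomial is an ordinary polynomial in \<open>q\<close>.
  If a Borel set \<open>A\<close> is non-null or non-meager, then for every \<open>y\<close> some direction \<open>u\<close> satisfies
  \<open>y + q u \<in> A\<close> for infinitely many of the rationals \<open>q = 1 + 1/(n+1)\<close>; so a generalized polynomial
  vanishing on \<open>A\<close> vanishes at \<open>y\<close>, the value at \<open>q = 0\<close>. If \<open>f\<close> is not identically zero, then the set
  of those \<open>x\<close> whose section of \<open>D\<close> is large lies in the zero set of \<open>f\<close>; this set is
  Borel, and it is large in the sense of the other ideal, a contradiction.
\<close>

section \<open>Generalized polynomials along rational lines\<close>

lemma additive_Rats_scale:
  fixes g :: "real \<Rightarrow> complex"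
  assumes add: "\<And>u v. g (u + v) = g u + g v" and q: "q \<in> \<rat>"
  shows "g (q * x) = of_real q * g x"
proof -
  have g0: "g 0 = 0"
    using add[of 0 0] by simp
  have nat: "g (of_nat n * x) = of_nat n * g x" for n x
    by (induction n) (simp_all add: g0 add algebra_simps)
  have neg: "g (- x) = - g x" for x
    using add[of x "- x"] g0 by (simp add: eq_neg_iff_add_eq_0 add.commute)
  have int: "g (of_int m * x) = of_int m * g x" for m x
    by (cases m rule: int_cases2) (simp_all add: nat neg)
  obtain a b where b: "b > 0" and qab: "q = of_int a / of_int b"
    using q by (metis Rats_cases')
  have "of_int b * g (q * x) = g (of_int b * (q * x))"
    by (simp add: int)
  also have "of_int b * (q * x) = of_int a * x"
    using b qab by simp
  also have "g (of_int a * x) = of_int a * g x"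
    by (rule int)
  finally show ?thesis
    using b by (simp add: qab field_simps)
qed

text \<open>Slots are filled with \<open>y + q * u\<close> one at a time. Additivity in slot
  \<open>m\<close> splits the value into one with \<open>y\<close> there and one with
  \<open>q * u\<close> there; rational homogeneity pulls \<open>q\<close> out of the second. The
  induction hypothesis, applied to two different base tuples, then gives
  \<open>P + [:0, 1:] * Q\<close>.\<close>

lemma k_additive_poly_line:
  assumes F: "k_additive k F"
  shows "m \<le> k \<Longrightarrow> t \<in> real_tuples k \<Longrightarrow>
    \<exists>P. \<forall>q\<in>\<rat>. F (\<lambda>i. if i < m then y + q * u else t i) = poly P (of_real q)"
proof (induction m arbitrary: t)
  case 0
  show ?case
    by (rule exI[of _ "[:F t:]"]) simp
next
  case (Suc m)
  have upd: "t(m := v) \<in> real_tuples k" for v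
    using Suc.prems by (auto simp: real_tuples_def PiE_iff extensional_def)
  obtain P where P: "\<And>q. q \<in> \<rat> \<Longrightarrow>
      F (\<lambda>i. if i < m then y + q * u else (t(m := y)) i) = poly P (of_real q)"
    using Suc.IH[OF _ upd[of y]] Suc.prems(1) by auto
  obtain Q where Q: "\<And>q. q \<in> \<rat> \<Longrightarrow>
      F (\<lambda>i. if i < m then y + q * u else (t(m := u)) i) = poly Q (of_real q)"
    using Suc.IH[OF _ upd[of u]] Suc.prems(1) by auto
  have "F (\<lambda>i. if i < Suc m then y + q * u else t i) = poly (P + [:0, 1:] * Q) (of_real q)"
    if q: "q \<in> \<rat>" for q
  proof -
    define s where "s = (\<lambda>i. if i < m then y + q * u else t i)"
    have s: "s \<in> real_tuples k"
      using Suc.prems by (auto simp: s_def real_tuples_def PiE_iff extensional_def)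
    have add: "F (s(m := v + w)) = F (s(m := v)) + F (s(m := w))" for v w
      using F s Suc.prems(1) unfolding k_additive_def by auto
    have eq: "s(m := v) = (\<lambda>i. if i < m then y + q * u else (t(m := v)) i)" for v
      by (auto simp: s_def)
    have "(\<lambda>i. if i < Suc m then y + q * u else t i) = s(m := y + q * u)"
      by (auto simp: s_def)
    then have "F (\<lambda>i. if i < Suc m then y + q * u else t i) = F (s(m := y)) + F (s(m := q * u))"
      by (simp add: add)
    also have "F (s(m := q * u)) = of_real q * F (s(m := u))"
      by (rule additive_Rats_scale[OF add q])
    finally show ?thesis
      using P[OF q] Q[OF q] by (simp only: eq) simp
  qed
  then show ?case
    by blast
qed

lemma generalized_polynomial_poly_line:
  assumes "generalized_polynomial f"
  shows "\<exists>P. \<forall>q\<in>\<rat>. f (y + q * u) = poly P (of_real q)"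
proof -
  obtain p g c where f: "\<And>x. f x = (\<Sum>k=0..p. g k x)" and c: "\<And>x. g 0 x = c"
    and g: "\<And>k. k \<in> {1..p} \<Longrightarrow>
      \<exists>F. k_additive k F \<and> symmetric_fun k F \<and> (\<forall>x. g k x = F (\<lambda>i\<in>{..<k}. x))"
    using assms unfolding generalized_polynomial_def by metis
  have "\<exists>P. \<forall>q\<in>\<rat>. g k (y + q * u) = poly P (of_real q)" if k: "k \<in> {0..p}" for k
  proof (cases "k = 0")
    case True
    then show ?thesis
      by (intro exI[of _ "[:c:]"]) (simp add: c)
  next
    case False
    then obtain F where F: "k_additive k F" and gF: "\<And>x. g k x = F (\<lambda>i\<in>{..<k}. x)"
      using g[of k] k by auto
    \<comment> \<open>The zero tuple serves only as an extensional base: all \<open>k\<close> slots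
      are overwritten, and outside \<open>{..<k}\<close> both sides are
      \<open>undefined\<close>.\<close>
    have "(\<lambda>i\<in>{..<k}. x) = (\<lambda>i. if i < k then x else (\<lambda>i\<in>{..<k}. 0) i)" for x :: real
      by (auto simp: restrict_def)
    moreover have "(\<lambda>i\<in>{..<k}. 0) \<in> real_tuples k"
      by (simp add: real_tuples_def)
    ultimately show ?thesis
      using k_additive_poly_line[OF F order_refl, of "\<lambda>i\<in>{..<k}. 0" y u] by (simp add: gF)
  qed
  then obtain P where P: "\<And>k q. k \<in> {0..p} \<Longrightarrow> q \<in> \<rat> \<Longrightarrow> g k (y + q * u) = poly (P k) (of_real q)"
    by metis
  then have "\<forall>q\<in>\<rat>. f (y + q * u) = poly (\<Sum>k=0..p. P k) (of_real q)"
    by (simp add: f poly_sum)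
  then show ?thesis
    by blast
qed

text \<open>The rationals \<open>1 + 1 / (n + 1)\<close> are pairwise distinct, so infinitely many
  zeros force the polynomial along the line to be zero. Its value at the rational 0 is
  \<open>f y\<close>.\<close>

lemma generalized_polynomial_zero_line:
  assumes f: "generalized_polynomial f"
    and inf: "infinite {n::nat. f (y + (1 + 1 / (real n + 1)) * u) = 0}"
  shows "f y = 0"
proof -
  let ?q = "\<lambda>n::nat. 1 + 1 / (real n + 1)"
  obtain P where P: "\<And>q. q \<in> \<rat> \<Longrightarrow> f (y + q * u) = poly P (of_real q)"
    using generalized_polynomial_poly_line[OF f] by metis
  have Q: "?q n \<in> \<rat>" for n
    by simp
  have "inj (\<lambda>n. complex_of_real (?q n))"
    by (auto simp: inj_on_def simp del: of_real_add of_real_divide)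
  then have "infinite ((\<lambda>n. complex_of_real (?q n)) ` {n. f (y + ?q n * u) = 0})"
    using inf finite_imageD inj_on_subset by blast
  moreover have "(\<lambda>n. complex_of_real (?q n)) ` {n. f (y + ?q n * u) = 0} \<subseteq> {z. poly P z = 0}"
    using P[OF Q] by (auto simp del: of_real_add of_real_divide)
  ultimately have "P = 0"
    using poly_roots_finite finite_subset by blast
  then show ?thesis
    using P[of 0] by simp
qed

section \<open>Meager sets and the Baire property\<close>

lemma nowhere_dense_imp_meager: "nowhere_dense A \<Longrightarrow> A \<in> meager_sets"
  unfolding meager_sets_def by (auto intro!: exI[of _ "\<lambda>_. A"])

lemma nowhere_dense_subset: "nowhere_dense B \<Longrightarrow> A \<subseteq> B \<Longrightarrow> nowhere_dense A"
  unfolding nowhere_dense_def by (metis closure_mono interior_mono subset_empty)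

lemma meager_empty: "{} \<in> meager_sets"
  by (rule nowhere_dense_imp_meager) (simp add: nowhere_dense_def)

lemma meager_subset:
  assumes "B \<in> meager_sets" "A \<subseteq> B"
  shows "A \<in> meager_sets"
proof -
  obtain S where S: "\<And>n::nat. nowhere_dense (S n)" "B = (\<Union>n. S n)"
    using assms(1) unfolding meager_sets_def by blast
  \<comment> \<open>\<open>meager_sets\<close> asks for equality with the union, so the pieces are
    cut down to \<open>A\<close>.\<close>
  have "nowhere_dense (S n \<inter> A)" for n
    using S(1) nowhere_dense_subset by blast
  moreover have "A = (\<Union>n. S n \<inter> A)"
    using S(2) assms(2) by blast
  ultimately show ?thesis
    unfolding meager_sets_def by (intro CollectI exI[of _ "\<lambda>n. S n \<inter> A"] conjI allI) auto
qed

lemma meager_UN: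
  assumes "\<And>n::nat. A n \<in> meager_sets"
  shows "(\<Union>n. A n) \<in> meager_sets"
proof -
  have "\<exists>S. \<forall>m::nat. nowhere_dense (S m) \<and> A n = (\<Union>m. S m)" for n
    using assms[of n] unfolding meager_sets_def by blast
  then obtain S where S: "\<And>n m::nat. nowhere_dense (S n m)" "\<And>n. A n = (\<Union>m. S n m)"
    by metis
  have "(\<Union>n. A n) = (\<Union>k. case prod_decode k of (n, m) \<Rightarrow> S n m)"
  proof (intro equalityI subsetI)
    fix x assume "x \<in> (\<Union>n. A n)"
    then obtain n m where "x \<in> S n m"
      using S(2) by blast
    then show "x \<in> (\<Union>k. case prod_decode k of (n, m) \<Rightarrow> S n m)"
      by (intro UN_I[of "prod_encode (n, m)"]) auto
  next
    fix x assume "x \<in> (\<Union>k. case prod_decode k of (n, m) \<Rightarrow> S n m)"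
    then obtain k where "x \<in> (case prod_decode k of (n, m) \<Rightarrow> S n m)"
      by (rule UN_E)
    then show "x \<in> (\<Union>n. A n)"
      by (cases "prod_decode k") (auto simp: S(2))
  qed
  moreover have "nowhere_dense (case prod_decode k of (n, m) \<Rightarrow> S n m)" for k
    using S(1) by (simp split: prod.split)
  ultimately show ?thesis
    unfolding meager_sets_def
    by (intro CollectI exI[of _ "\<lambda>k. case prod_decode k of (n, m) \<Rightarrow> S n m"] conjI allI) auto
qed

lemma meager_Un:
  assumes "A \<in> meager_sets" "B \<in> meager_sets"
  shows "A \<union> B \<in> meager_sets"
proof -
  have "(\<Union>n::nat. if n = 0 then A else B) \<in> meager_sets"
    using assms by (intro meager_UN) auto
  then show ?thesis
    by (rule meager_subset) (auto split: if_splits)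
qed

lemma open_not_meager:
  assumes "open W" "W \<noteq> {}"
  shows "W \<notin> meager_sets"
proof
  assume "W \<in> meager_sets"
  then obtain S where S: "\<And>n::nat. nowhere_dense (S n)" "W = (\<Union>n. S n)"
    unfolding meager_sets_def by blast
  \<comment> \<open>The complements of the closures are open and dense, so the Baire category
    theorem makes their intersection dense; yet it misses \<open>W\<close>.\<close>
  have "UNIV \<subseteq> closure (\<Inter>(range (\<lambda>n. - closure (S n))))"
    using S(1) by (intro Baire) (auto simp: closure_complement nowhere_dense_def)
  moreover have "W \<inter> \<Inter>(range (\<lambda>n. - closure (S n))) = {}"
    using S(2) closure_subset by fastforce
  then have "W \<inter> closure (\<Inter>(range (\<lambda>n. - closure (S n)))) = {}"
    using assms(1) open_Int_closure_eq_empty by blast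
  ultimately show False
    using assms(2) by blast
qed

lemma nowhere_dense_affine_vimage:
  fixes a y :: real
  assumes S: "nowhere_dense S" and a: "a \<noteq> 0"
  shows "nowhere_dense ((\<lambda>u. y + a * u) -` S)"
proof -
  let ?f = "\<lambda>u. y + a * u"
  define V where "V = interior (?f -` closure S)"
  \<comment> \<open>The image of \<open>V\<close> is open, being the preimage of \<open>V\<close>
    under the inverse affine map.\<close>
  have "?f ` V = (\<lambda>z. (z - y) / a) -` V"
    using a by (force simp: image_iff field_simps)
  moreover have "open ((\<lambda>z. (z - y) / a) -` V)"
    unfolding V_def by (intro open_vimage open_interior continuous_intros) (use a in auto)
  moreover have "?f ` V \<subseteq> closure S"
    using interior_subset unfolding V_def by blast
  ultimately have "?f ` V \<subseteq> interior (closure S)"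
    by (simp add: interior_maximal)
  then have "V = {}"
    using S by (simp add: nowhere_dense_def)
  moreover have "closed (?f -` closure S)"
    by (intro closed_vimage closed_closure continuous_intros)
  then have "closure (?f -` S) \<subseteq> ?f -` closure S"
    by (intro closure_minimal vimage_mono closure_subset)
  ultimately show ?thesis
    unfolding V_def nowhere_dense_def by (metis interior_mono subset_empty)
qed

lemma meager_affine_vimage:
  fixes a y :: real
  assumes "S \<in> meager_sets" "a \<noteq> 0"
  shows "(\<lambda>u. y + a * u) -` S \<in> meager_sets"
proof -
  obtain T where T: "\<And>n::nat. nowhere_dense (T n)" "S = (\<Union>n. T n)"
    using assms(1) unfolding meager_sets_def by blast
  have "(\<Union>n. (\<lambda>u. y + a * u) -` T n) \<in> meager_sets"
    by (intro meager_UN nowhere_dense_imp_meager nowhere_dense_affine_vimage T assms)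
  then show ?thesis
    by (simp add: T(2) vimage_UN)
qed

text \<open>The sets that are open up to a meager error contain the open sets and form a
  sigma-algebra. For a complement, the open set \<open>interior (- W)\<close> differs from
  \<open>- W\<close> only inside the nowhere dense frontier of \<open>W\<close>.\<close>

lemma borel_Baire_property:
  fixes A :: "real set"
  assumes "A \<in> sets borel"
  shows "\<exists>W. open W \<and> A - W \<in> meager_sets \<and> W - A \<in> meager_sets"
proof -
  have "A \<in> sigma_sets UNIV {S. open S}"
    using assms by (simp add: borel_def)
  then show ?thesis
  proof (induction rule: sigma_sets.induct)
    case (Basic A)
    then show ?case
      by (intro exI[of _ A]) (simp add: meager_empty)
  next
    case Empty
    show ?case
      by (intro exI[of _ "{}"]) (simp add: meager_empty)
  next
    case (Compl A)
    then obtain W where W: "open W" "A - W \<in> meager_sets" "W - A \<in> meager_sets"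
      by blast
    \<comment> \<open>An open set that misses \<open>W\<close> also misses its closure, whereas the
      frontier lies in that closure. Hence the frontier has empty interior.\<close>
    have "interior (frontier W) \<inter> W = {}"
      using W(1) interior_subset[of "frontier W"] by (auto simp: frontier_def interior_open)
    then have "interior (frontier W) \<inter> closure W = {}"
      by (simp add: open_Int_closure_eq_empty)
    moreover have "interior (frontier W) \<subseteq> closure W"
      using interior_subset[of "frontier W"] by (auto simp: frontier_def)
    ultimately have "nowhere_dense (frontier W)"
      by (auto simp: nowhere_dense_def)
    then have fr: "frontier W \<in> meager_sets"
      by (rule nowhere_dense_imp_meager)
    have "(UNIV - A) - interior (- W) \<subseteq> (W - A) \<union> frontier W"
      using closure_subset[of W] W(1) by (auto simp: frontier_def interior_complement interior_open)
    moreover have "interior (- W) - (UNIV - A) \<subseteq> A - W"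
      using interior_subset by blast
    ultimately show ?case
      using W meager_Un[OF W(3) fr] by (intro exI[of _ "interior (- W)"]) (auto intro: meager_subset)
  next
    case (Union A)
    then obtain W where W: "\<And>n. open (W n)" "\<And>n. A n - W n \<in> meager_sets" "\<And>n. W n - A n \<in> meager_sets"
      by metis
    have "(\<Union>n. A n) - (\<Union>n. W n) \<in> meager_sets"
      by (rule meager_subset[OF meager_UN[of "\<lambda>n. A n - W n", OF W(2)]]) blast
    moreover have "(\<Union>n. W n) - (\<Union>n. A n) \<in> meager_sets"
      by (rule meager_subset[OF meager_UN[of "\<lambda>n. W n - A n", OF W(3)]]) blast
    ultimately show ?case
      using W(1) by (intro exI[of _ "\<Union>n. W n"]) auto
  qed
qed

text \<open>The open set from the Baire property is nonempty, since otherwise \<open>A\<close> would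
  equal its meager error \<open>A - W\<close>.\<close>

lemma borel_nonmeager_comeager_open:
  fixes A :: "real set"
  assumes "A \<in> sets borel" "A \<notin> meager_sets"
  obtains W where "open W" "W \<noteq> {}" "W - A \<in> meager_sets"
  using borel_Baire_property[OF assms(1)] assms(2) by (metis Diff_empty)

section \<open>Sections of planar Borel sets and category\<close>

lemma borel_section:
  assumes "D \<in> sets (borel :: (real \<times> real) measure)"
  shows "Pair x -` D \<in> sets borel"
  using assms sets_Pair1[of D borel borel x] by (simp only: borel_prod)

text \<open>The localisation to \<open>U\<close> is what carries the induction through complements:
  there, being nonmeager in \<open>U\<close> becomes meagerness of the section of \<open>D\<close>
  in some smaller basic open set, so the hypothesis is needed for all open sets at once.\<close>

lemma borel_nonmeager_sections:
  assumes "D \<in> sets (borel :: (real \<times> real) measure)" "open U"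
  shows "{x. Pair x -` D \<inter> U \<notin> meager_sets} \<in> sets borel"
proof -
  obtain B :: "real set set" where B: "countable B" "\<And>C. C \<in> B \<Longrightarrow> open C"
    "\<And>S. open S \<Longrightarrow> \<exists>V. V \<subseteq> B \<and> S = \<Union>V"
    using univ_second_countable by metis
  have "D \<in> sigma_sets UNIV {S. open S}"
    using assms(1) by (simp add: borel_def)
  then show ?thesis
    using assms(2)
  proof (induction arbitrary: U rule: sigma_sets.induct)
    case (Basic D)
    have "open (Pair x -` D)" for x
      using Basic by (intro open_vimage continuous_intros) auto
    then have "open (Pair x -` D \<inter> U)" for x
      using Basic by blast
    \<comment> \<open>By the Baire category theorem an open section is nonmeager as soon as it is
      nonempty, which reduces the claim to a projection of an open set.\<close>
    then have "Pair x -` D \<inter> U \<notin> meager_sets \<longleftrightarrow> Pair x -` D \<inter> U \<noteq> {}" for x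
      using open_not_meager meager_empty by metis
    then have "{x. Pair x -` D \<inter> U \<notin> meager_sets} = (\<Union>y\<in>U. (\<lambda>x. (x, y)) -` D)"
      by auto
    moreover have "open ((\<lambda>x. (x, y)) -` D)" for y
      using Basic by (intro open_vimage continuous_intros) auto
    ultimately have "open {x. Pair x -` D \<inter> U \<notin> meager_sets}"
      by auto
    then show ?case
      by simp
  next
    case Empty
    show ?case
      by (simp add: meager_empty)
  next
    case (Compl D)
    have D: "D \<in> sets borel"
      using Compl.hyps by (simp add: borel_def)
    define C where "C = {V\<in>B. V \<noteq> {} \<and> V \<subseteq> U}"
    \<comment> \<open>Forwards, the Baire property gives an open \<open>W\<close> in which the
      complementary section is comeager, and a basic set inside \<open>W \<inter> U\<close> works.
      Backwards, \<open>V\<close> would otherwise be a union of two meager sets. Countability of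
      \<open>C\<close> then yields a Borel set.\<close>
    have eq: "Pair x -` (UNIV - D) \<inter> U \<notin> meager_sets \<longleftrightarrow> (\<exists>V\<in>C. Pair x -` D \<inter> V \<in> meager_sets)" for x
    proof
      assume nm: "Pair x -` (UNIV - D) \<inter> U \<notin> meager_sets"
      have "Pair x -` (UNIV - D) \<inter> U \<in> sets borel"
        using borel_section[OF D, of x] Compl.prems by (auto simp: vimage_Diff)
      then obtain W where W: "open W" "W - Pair x -` (UNIV - D) \<inter> U \<in> meager_sets" "W \<noteq> {}"
        using nm borel_nonmeager_comeager_open by metis
      have "W \<inter> U \<noteq> {}"
      proof
        assume "W \<inter> U = {}"
        then have "W - Pair x -` (UNIV - D) \<inter> U = W"
          by blast
        then show False
          using W open_not_meager by metis
      qed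
      moreover have "open (W \<inter> U)"
        using W(1) Compl.prems by blast
      ultimately obtain V where V: "V \<in> B" "V \<noteq> {}" "V \<subseteq> W \<inter> U"
        using B(3)[of "W \<inter> U"] by (metis Sup_le_iff Union_empty_conv subset_iff order_refl)
      have "Pair x -` D \<inter> V \<in> meager_sets"
        by (rule meager_subset[OF W(2)]) (use V in auto)
      then show "\<exists>V\<in>C. Pair x -` D \<inter> V \<in> meager_sets"
        using V by (auto simp: C_def)
    next
      assume "\<exists>V\<in>C. Pair x -` D \<inter> V \<in> meager_sets"
      then obtain V where V: "V \<in> B" "V \<noteq> {}" "V \<subseteq> U" "Pair x -` D \<inter> V \<in> meager_sets"
        by (auto simp: C_def)
      show "Pair x -` (UNIV - D) \<inter> U \<notin> meager_sets"
      proof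
        assume "Pair x -` (UNIV - D) \<inter> U \<in> meager_sets"
        then have "Pair x -` (UNIV - D) \<inter> U \<union> Pair x -` D \<inter> V \<in> meager_sets"
          using V(4) by (rule meager_Un)
        then have "V \<in> meager_sets"
          by (rule meager_subset) (use V(3) in auto)
        then show False
          using open_not_meager B(2) V by blast
      qed
    qed
    have "{x. Pair x -` D \<inter> V \<in> meager_sets} \<in> sets borel" if "V \<in> C" for V
    proof -
      have "{x. Pair x -` D \<inter> V \<notin> meager_sets} \<in> sets borel"
        using that B(2) by (intro Compl.IH) (auto simp: C_def)
      then have "- {x. Pair x -` D \<inter> V \<notin> meager_sets} \<in> sets borel"
        by (rule borel_comp)
      moreover have "- {x. Pair x -` D \<inter> V \<notin> meager_sets} = {x. Pair x -` D \<inter> V \<in> meager_sets}"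
        by auto
      ultimately show ?thesis
        by simp
    qed
    moreover have "countable C"
      using B(1) by (auto simp: C_def intro: countable_subset)
    ultimately have "(\<Union>V\<in>C. {x. Pair x -` D \<inter> V \<in> meager_sets}) \<in> sets borel"
      by (intro sets.countable_UN') auto
    moreover have "(\<Union>V\<in>C. {x. Pair x -` D \<inter> V \<in> meager_sets})
        = {x. Pair x -` (UNIV - D) \<inter> U \<notin> meager_sets}"
      using eq by auto
    ultimately show ?case
      by simp
  next
    case (Union D)
    have "Pair x -` (\<Union>n. D n) \<inter> U \<notin> meager_sets \<longleftrightarrow> (\<exists>n. Pair x -` D n \<inter> U \<notin> meager_sets)" for x
    proof
      assume nm: "Pair x -` (\<Union>n. D n) \<inter> U \<notin> meager_sets"
      have "Pair x -` (\<Union>n. D n) \<inter> U = (\<Union>n. Pair x -` D n \<inter> U)"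
        by blast
      then show "\<exists>n. Pair x -` D n \<inter> U \<notin> meager_sets"
        using nm meager_UN by metis
    next
      assume "\<exists>n. Pair x -` D n \<inter> U \<notin> meager_sets"
      then obtain n where "Pair x -` D n \<inter> U \<notin> meager_sets"
        by blast
      moreover have "Pair x -` D n \<inter> U \<subseteq> Pair x -` (\<Union>n. D n) \<inter> U"
        by blast
      ultimately show "Pair x -` (\<Union>n. D n) \<inter> U \<notin> meager_sets"
        by (metis meager_subset)
    qed
    then have "{x. Pair x -` (\<Union>n. D n) \<inter> U \<notin> meager_sets} = (\<Union>n. {x. Pair x -` D n \<inter> U \<notin> meager_sets})"
      by auto
    then show ?case
      using Union by auto
  qed
qed

section \<open>Rational lines meeting a large set infinitely often\<close>

text \<open>\<open>A\<close> is comeager in a nonempty open \<open>W\<close>. Directions that send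
  some point of the line into \<open>W - A\<close> form a meager set, so one with
  \<open>y + u\<close> in \<open>W\<close> avoids it. The parameters tend to 1, hence the points
  eventually enter \<open>W\<close> and therefore \<open>A\<close>.\<close>

lemma nonmeager_line:
  fixes A :: "real set" and y :: real
  assumes A: "A \<in> sets borel" "A \<notin> meager_sets"
  shows "\<exists>u. infinite {n::nat. y + (1 + 1 / (real n + 1)) * u \<in> A}"
proof -
  let ?q = "\<lambda>n::nat. 1 + 1 / (real n + 1)"
  obtain W where W: "open W" "W \<noteq> {}" "W - A \<in> meager_sets"
    using borel_nonmeager_comeager_open[OF A] .
  have q0: "?q n \<noteq> 0" for n
    by (simp add: add_pos_pos less_imp_neq[symmetric])
  have "(\<Union>n. (\<lambda>u. y + ?q n * u) -` (W - A)) \<in> meager_sets"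
    by (intro meager_UN meager_affine_vimage W q0)
  moreover have "(\<lambda>u. y + u) -` W \<notin> meager_sets"
  proof (rule open_not_meager)
    show "open ((\<lambda>u. y + u) -` W)"
      using W(1) by (intro open_vimage continuous_intros)
    obtain w where "w \<in> W"
      using W(2) by blast
    then have "w - y \<in> (\<lambda>u. y + u) -` W"
      by simp
    then show "(\<lambda>u. y + u) -` W \<noteq> {}"
      by blast
  qed
  ultimately obtain u where u: "y + u \<in> W" "\<And>n. y + ?q n * u \<notin> W - A"
    using meager_subset[of "\<Union>n. (\<lambda>u. y + ?q n * u) -` (W - A)" "(\<lambda>u. y + u) -` W"] by blast
  have "(\<lambda>n. y + ?q n * u) \<longlonglongrightarrow> y + (1 + 0) * u"
    by (intro tendsto_intros) (use lim_inverse_n' LIMSEQ_Suc[OF lim_inverse_n'] in \<open>simp add: add.commute\<close>)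
  then have "\<forall>\<^sub>F n in sequentially. y + ?q n * u \<in> W"
    using W(1) u(1) by (intro topological_tendstoD) auto
  then have "\<forall>\<^sub>F n in sequentially. y + ?q n * u \<in> A"
    by eventually_elim (use u(2) in blast)
  then have "infinite {n. y + ?q n * u \<in> A}"
    using frequently_cofinite[of "\<lambda>n. y + ?q n * u \<in> A"]
    by (simp add: cofinite_eq_sequentially eventually_frequently)
  then show ?thesis
    by blast
qed

text \<open>For a bounded piece \<open>B\<close> of positive measure, the sets \<open>E n\<close> of
  directions hitting \<open>B\<close> at the \<open>n\<close>-th parameter lie in a common interval
  and have measure bounded below. Their upper limit therefore has positive measure, and any
  direction in it works.\<close>

lemma nonnull_line:
  fixes A :: "real set" and y :: real
  assumes A: "A \<in> sets borel" "A \<notin> lebesgue_null_sets"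
  shows "\<exists>u. infinite {n::nat. y + (1 + 1 / (real n + 1)) * u \<in> A}"
proof -
  let ?q = "\<lambda>n::nat. 1 + 1 / (real n + 1)"
  have q: "1 \<le> ?q n" "?q n \<le> 2" for n
    by (auto simp: field_simps)
  have q0: "?q n \<noteq> 0" for n
    using q(1)[of n] by linarith
  \<comment> \<open>Truncation ensures finite measure, which continuity from above requires
    below.\<close>
  obtain K :: nat where K: "A \<inter> {- real K..real K} \<notin> null_sets lebesgue"
  proof (rule ccontr)
    assume "\<not> thesis"
    then have "(\<Union>K::nat. A \<inter> {- real K..real K}) \<in> null_sets lebesgue"
      using that by (intro null_sets_UN) blast
    moreover have "(\<Union>K::nat. A \<inter> {- real K..real K}) = A"
    proof -
      have "\<exists>K::nat. - real K \<le> x \<and> x \<le> real K" for x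
        using real_arch_simple[of "\<bar>x\<bar>"] by (metis abs_le_iff minus_le_iff)
      then show ?thesis
        by auto
    qed
    ultimately show False
      using A(2) by (simp add: lebesgue_null_sets_def)
  qed
  define B where "B = A \<inter> {- real K..real K}"
  have B: "B \<in> sets borel"
    using A(1) by (simp add: B_def)
  define c where "c = emeasure lebesgue B"
  have c: "c > 0"
    using K B by (auto simp: c_def B_def null_sets_def zero_less_iff_neq_zero)
  define E where "E n = (\<lambda>u. y + ?q n * u) -` B" for n
  have E: "E n \<in> sets lebesgue" for n
  proof -
    have "(\<lambda>u. y + ?q n * u) \<in> borel_measurable borel"
      by (intro borel_measurable_continuous_onI continuous_intros)
    then have "E n \<in> sets borel"
      using measurable_sets[of "\<lambda>u. y + ?q n * u" borel borel B] B by (simp only: E_def space_borel Int_UNIV_right)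
    then show ?thesis
      by simp
  qed
  \<comment> \<open>Solving for \<open>u\<close> presents \<open>E n\<close> as an affine image of
    \<open>B\<close>, so its measure is that of \<open>B\<close> divided by the parameter.\<close>
  have "E n = (\<lambda>x. inverse (?q n) *\<^sub>R x + (- y / ?q n)) ` B" for n
  proof -
    have "(\<lambda>u. y + a * u) -` B = (\<lambda>x. inverse a *\<^sub>R x + (- y / a)) ` B" if "a \<noteq> 0" for a
      using that by (force simp: image_iff field_simps)
    then show ?thesis
      unfolding E_def using q0 by blast
  qed
  then have Em: "emeasure lebesgue (E n) = ennreal (inverse (?q n)) * c" for n
    using q(1)[of n] by (simp only: emeasure_lebesgue_affine c_def) simp
  have half: "emeasure lebesgue (E n) \<ge> ennreal (1/2) * c" for n
  proof -
    \<comment> \<open>The constant 1/2 comes from the bound 2 on the parameters.\<close>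
    have "1 / 2 \<le> inverse (?q n)"
      by (simp add: field_simps)
    then show ?thesis
      unfolding Em by (intro mult_right_mono ennreal_leI) simp_all
  qed
  \<comment> \<open>This radius works for every \<open>n\<close> because the parameters are at least
    1, so that \<open>u\<close> is no larger in absolute value than its multiple.\<close>
  define R where "R = real K + \<bar>y\<bar>"
  have ER: "E n \<subseteq> {- R..R}" for n
  proof
    fix u assume "u \<in> E n"
    then have "\<bar>y + ?q n * u\<bar> \<le> real K"
      by (auto simp: E_def B_def)
    then have "\<bar>?q n * u\<bar> \<le> R"
      by (simp add: R_def)
    moreover have "\<bar>u\<bar> \<le> \<bar>?q n * u\<bar>"
      using mult_right_mono[OF q(1)[of n] abs_ge_zero[of u]] q(1)[of n] by (simp add: abs_mult)
    ultimately show "u \<in> {- R..R}"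
      by auto
  qed
  \<comment> \<open>A direction belongs to every tail union exactly when it belongs to infinitely
    many \<open>E n\<close>.\<close>
  define T where "T m = (\<Union>n\<in>{m..}. E n)" for m
  have T: "T m \<in> sets lebesgue" for m
    unfolding T_def by (intro sets.countable_UN') (auto simp: E)
  have "emeasure lebesgue (T m) \<le> emeasure lebesgue {- R..R}" for m
    using ER by (intro emeasure_mono) (auto simp: T_def)
  then have "emeasure lebesgue (T m) \<noteq> \<infinity>" for m
    using neq_top_trans[of "emeasure lebesgue {- R..R}"] by (simp add: emeasure_lborel_Icc_eq)
  moreover have "decseq T"
    unfolding decseq_def T_def by (intro allI impI UN_mono) auto
  ultimately have "(INF m. emeasure lebesgue (T m)) = emeasure lebesgue (\<Inter>m. T m)"
    using T by (intro INF_emeasure_decseq') auto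
  moreover have "(INF m. emeasure lebesgue (T m)) \<ge> ennreal (1/2) * c"
  proof (rule INF_greatest)
    fix m
    have "emeasure lebesgue (E m) \<le> emeasure lebesgue (T m)"
      using T by (intro emeasure_mono) (auto simp: T_def)
    then show "ennreal (1/2) * c \<le> emeasure lebesgue (T m)"
      using half[of m] by order
  qed
  moreover have "ennreal (1/2) * c > 0"
    using c by (simp only: ennreal_zero_less_mult_iff ennreal_less_zero_iff) simp
  ultimately have "(\<Inter>m. T m) \<noteq> {}"
    by (metis emeasure_empty leD)
  then obtain u where "\<And>m. u \<in> T m"
    by blast
  then have "infinite {n. u \<in> E n}"
    by (auto simp: T_def infinite_nat_iff_unbounded_le Bex_def)
  moreover have "{n. u \<in> E n} \<subseteq> {n. y + ?q n * u \<in> A}"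
    by (auto simp: E_def B_def)
  ultimately show ?thesis
    using finite_subset by blast
qed

section \<open>Large zero sets and the conclusion\<close>

lemma generalized_polynomial_eq_0_of_large_zero_set:
  assumes f: "generalized_polynomial f"
    and A: "A \<in> sets borel" "A \<notin> meager_sets \<or> A \<notin> lebesgue_null_sets"
    and zero: "\<And>x. x \<in> A \<Longrightarrow> f x = 0"
  shows "f y = 0"
proof -
  obtain u where "infinite {n::nat. y + (1 + 1 / (real n + 1)) * u \<in> A}"
    using A nonmeager_line nonnull_line by metis
  moreover have "{n::nat. y + (1 + 1 / (real n + 1)) * u \<in> A}
      \<subseteq> {n. f (y + (1 + 1 / (real n + 1)) * u) = 0}"
    using zero by blast
  ultimately show ?thesis
    using generalized_polynomial_zero_line[OF f] finite_subset by blast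
qed

lemma borel_nonnull_sections:
  assumes D: "D \<in> sets (borel :: (real \<times> real) measure)"
  shows "{x. Pair x -` D \<notin> lebesgue_null_sets} \<in> sets borel"
proof -
  \<comment> \<open>On Borel sections the completed measure agrees with \<open>lborel\<close>, whose
    section measure is a Borel function of \<open>x\<close>.\<close>
  have "Pair x -` D \<in> lebesgue_null_sets \<longleftrightarrow> emeasure lborel (Pair x -` D) = 0" for x
    using borel_section[OF D, of x] by (auto simp: lebesgue_null_sets_def null_sets_def)
  moreover have "(\<lambda>x. emeasure lborel (Pair x -` D)) \<in> borel_measurable borel"
    using D by (intro lborel.measurable_emeasure_Pair) (simp only: borel_prod sets_pair_measure_cong[OF refl sets_lborel])
  then have "{x. emeasure lborel (Pair x -` D) \<noteq> 0} \<in> sets borel"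
    by measurable
  ultimately show ?thesis
    by simp
qed

theorem theorem3p5:
  fixes f :: "real \<Rightarrow> complex" and D :: "(real \<times> real) set"
  assumes "generalized_polynomial f"
    and "D \<in> sets borel"
    and "D \<notin> meager_sets \<otimes>\<^sub>F lebesgue_null_sets \<or> D \<notin> lebesgue_null_sets \<otimes>\<^sub>F meager_sets"
    and "\<And>x y. (x, y) \<in> D \<Longrightarrow> f x * f y = 0"
  shows "\<forall>x. f x = 0"
proof (rule ccontr)
  assume "\<not> (\<forall>x. f x = 0)"
  then obtain z where z: "f z \<noteq> 0"
    by blast
  \<comment> \<open>Since \<open>f z\<close> is nonzero, every Borel subset of the zero set is small
    in both senses. This is what lets the two ideals be interchanged.\<close>
  have small: "A \<in> meager_sets \<and> A \<in> lebesgue_null_sets"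
    if "A \<in> sets borel" "\<And>x. x \<in> A \<Longrightarrow> f x = 0" for A
    using generalized_polynomial_eq_0_of_large_zero_set[OF assms(1), of A z] that z by blast
  \<comment> \<open>If \<open>f x\<close> is nonzero, the product condition puts the whole section
    over \<open>x\<close> into the zero set.\<close>
  have sec: "Pair x -` D \<in> meager_sets \<and> Pair x -` D \<in> lebesgue_null_sets" if "f x \<noteq> 0" for x
    using small[OF borel_section[OF assms(2), of x]] assms(4) that by fastforce
  \<comment> \<open>By contraposition of \<open>sec\<close>, points with a large section are zeros
    of \<open>f\<close>; they form a Borel set, to which \<open>small\<close> applies.\<close>
  have "{x. Pair x -` D \<notin> lebesgue_null_sets} \<in> meager_sets"
    using small[OF borel_nonnull_sections[OF assms(2)]] sec by blast
  moreover have "{x. Pair x -` D \<notin> meager_sets} \<in> lebesgue_null_sets"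
    using small[OF borel_nonmeager_sections[OF assms(2) open_UNIV, unfolded Int_UNIV_right]] sec by blast
  \<comment> \<open>\<open>D\<close> is its own Borel cover, so it lies in both Fubini
    products.\<close>
  ultimately show False
    using assms(2,3) unfolding fubini_product_def vimage_def by blast
qed

end
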